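(* Let $S$ be a finite $p$-group for an odd prime $p$. If every subgroup $L$ of $S$ with $\mathfrak{X}(S)\leq L\leq J(S)\mathfrak{X}(S)$ is normal in $S$, then $J(S)\leq \mathfrak{X}(S)$.
   Context: For a finite $p$-group $G$ and subgroups $A,B$, write $[A,B;1]=[A,B]$ and $[A,B;k]=[[A,B;k-1],B]$. $\Omega_1(G)$ denotes the subgroup generated by the elements of order $p$ in $G$. The Oliver subgroup $\mathfrak{X}(G)$ of a finite $p$-group $G$ is the unique largest normal subgroup $K$ of $G$ admitting a chain $1=Q_0\leq Q_1\leq\cdots\leq Q_n=K$ of normal subgroups $Q_i\unlhd G$ such that $[\Omega_1(C_G(Q_{i-1})),Q_i;p-1]=1$ for each $1\leq i\leq n$. $J(S)$ is the Thompson subgroup of $S$: the subgroup generated by all elementary abelian $p$-subgroups of $S$ whose rank equals the $p$-rank of $S$ (the largest rank of an elementary abelian $p$-subgroup of $S$). *)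

theory Defs
  imports "HOL-Algebra.Algebra" "HOL-Algebra.Multiplicative_Group"
begin

definition p_group :: "('a, 'b) monoid_scheme \<Rightarrow> nat \<Rightarrow> bool" where
  "p_group G p \<longleftrightarrow> group G \<and> finite (carrier G) \<and> (\<exists>n. card (carrier G) = p ^ n)"

definition comm_subgroup :: "('a, 'b) monoid_scheme \<Rightarrow> 'a set \<Rightarrow> 'a set \<Rightarrow> 'a set" where
  "comm_subgroup G A B = generate G
     {inv\<^bsub>G\<^esub> a \<otimes>\<^bsub>G\<^esub> inv\<^bsub>G\<^esub> b \<otimes>\<^bsub>G\<^esub> a \<otimes>\<^bsub>G\<^esub> b | a b. a \<in> A \<and> b \<in> B}"

fun iter_comm :: "('a, 'b) monoid_scheme \<Rightarrow> 'a set \<Rightarrow> 'a set \<Rightarrow> nat \<Rightarrow> 'a set" where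
  "iter_comm G A B 0 = A"
| "iter_comm G A B (Suc k) = comm_subgroup G (iter_comm G A B k) B"

definition centralizer :: "('a, 'b) monoid_scheme \<Rightarrow> 'a set \<Rightarrow> 'a set" where
  "centralizer G Q = {g \<in> carrier G. \<forall>q \<in> Q. g \<otimes>\<^bsub>G\<^esub> q = q \<otimes>\<^bsub>G\<^esub> g}"

definition Omega1 :: "('a, 'b) monoid_scheme \<Rightarrow> nat \<Rightarrow> 'a set \<Rightarrow> 'a set" where
  "Omega1 G p H = generate G {x \<in> H. group.ord G x = p}"

definition oliver_admissible :: "('a, 'b) monoid_scheme \<Rightarrow> nat \<Rightarrow> 'a set \<Rightarrow> bool" where
  "oliver_admissible (G :: ('a, 'b) monoid_scheme) p K \<longleftrightarrow> K \<lhd> G \<and>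
     (\<exists>(n::nat) (Q :: nat \<Rightarrow> 'a set). Q 0 = {\<one>\<^bsub>G\<^esub>} \<and> Q n = K \<and> (\<forall>i\<le>n. Q i \<lhd> G) \<and>
        (\<forall>i\<in>{1..n}. Q (i - 1) \<subseteq> Q i \<and>
           iter_comm G (Omega1 G p (centralizer G (Q (i - 1)))) (Q i) (p - 1) = {\<one>\<^bsub>G\<^esub>}))"

definition oliver_subgroup :: "('a, 'b) monoid_scheme \<Rightarrow> nat \<Rightarrow> 'a set" where
  "oliver_subgroup G p = (THE K. oliver_admissible G p K \<and> (\<forall>K'. oliver_admissible G p K' \<longrightarrow> K' \<subseteq> K))"

definition elem_abelian :: "('a, 'b) monoid_scheme \<Rightarrow> nat \<Rightarrow> 'a set \<Rightarrow> bool" where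
  "elem_abelian G p E \<longleftrightarrow> subgroup E G \<and> finite E \<and>
     (\<forall>x\<in>E. \<forall>y\<in>E. x \<otimes>\<^bsub>G\<^esub> y = y \<otimes>\<^bsub>G\<^esub> x) \<and>
     (\<forall>x\<in>E. x \<noteq> \<one>\<^bsub>G\<^esub> \<longrightarrow> group.ord G x = p)"

definition elem_ab_rank :: "nat \<Rightarrow> 'a set \<Rightarrow> nat" where
  "elem_ab_rank p E = (THE r. card E = p ^ r)"

definition p_rank :: "('a, 'b) monoid_scheme \<Rightarrow> nat \<Rightarrow> nat" where
  "p_rank G p = Max {elem_ab_rank p E | E. elem_abelian G p E}"

definition thompson_subgroup :: "('a, 'b) monoid_scheme \<Rightarrow> nat \<Rightarrow> 'a set" where
  "thompson_subgroup G p = generate G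
     (\<Union>{E. elem_abelian G p E \<and> elem_ab_rank p E = p_rank G p})"

end

theory Submission
  imports Defs
begin

text \<open>
  Write \<open>U\<close> for the Oliver subgroup. By maximality of \<open>U\<close>, no normal subgroup \<open>L\<close> properly containing
  \<open>U\<close> satisfies \<open>[\<Omega>\<^sub>1(C(U)), L; p - 1] = 1\<close>. As \<open>p - 1 \<ge> 2\<close>, this forces \<open>C(U) \<le> U\<close>, so that
  \<open>V = \<Omega>\<^sub>1(C(U))\<close> is elementary abelian and centralized by \<open>U\<close>.

  Suppose that some elementary abelian \<open>E\<close> of maximal rank is not contained in \<open>U\<close>, and choose it with
  \<open>E \<inter> V\<close> as large as possible. If \<open>V\<close> normalizes \<open>E\<close>, then \<open>[V, EU, EU] = [V, E, E] = 1\<close>, while \<open>EU\<close>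
  is normal by hypothesis: a contradiction. Otherwise Thompson's replacement argument gives an
  elementary abelian \<open>A\<close> of maximal rank with \<open>E \<inter> V < A \<inter> V\<close> and \<open>V\<close> not contained in \<open>A\<close>. By the
  choice of \<open>E\<close> we have \<open>A \<le> U\<close>; then \<open>AV\<close> is elementary abelian, so \<open>V \<le> A\<close> by maximality of the
  rank, again a contradiction.
\<close>

section \<open>Fixed points of p-groups acting on sets and on cosets\<close>

text \<open>Orbits have \<open>p\<close>-power length, so every orbit that is not a single point has
  length divisible by \<open>p\<close>. If \<open>x0\<close> were the only fixed point in
  \<open>F\<close>, then \<open>card F\<close> would be 1 modulo \<open>p\<close>. The invariant set
  \<open>F\<close> is kept apart from \<open>E\<close> so that an action on a large set can be used
  on a small part of it.\<close>

lemma (in group_action) ex_second_fixed_point: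
  assumes p: "Factorial_Ring.prime p" and ord: "order G = p ^ n"
    and F: "finite F" "F \<subseteq> E" "\<And>g x. g \<in> carrier G \<Longrightarrow> x \<in> F \<Longrightarrow> \<phi> g x \<in> F"
    and dvd: "p dvd card F"
    and x0: "x0 \<in> F" "\<And>g. g \<in> carrier G \<Longrightarrow> \<phi> g x0 = x0"
  shows "\<exists>x\<in>F. x \<noteq> x0 \<and> (\<forall>g\<in>carrier G. \<phi> g x = x)"
proof (rule ccontr)
  assume no: "\<not> ?thesis"
  have self: "x \<in> orbit G \<phi> x" if "x \<in> F" for x
    using orbit_refl that F(2) by blast
  have sub: "orbit G \<phi> x \<subseteq> F" if "x \<in> F" for x
    using that F(3) by (auto simp: orbit_def)
  define O1 where "O1 = orbit G \<phi> ` F"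
  have O1_sub: "O1 \<subseteq> orbits G E \<phi>"
    using F(2) by (auto simp: O1_def orbits_def)
  have disj: "A \<inter> B = {}" if "A \<in> O1" "B \<in> O1" "A \<noteq> B" for A B
    using that disjoint_union O1_sub by blast
  have U: "\<Union>O1 = F"
    using self sub by (auto simp: O1_def)
  have fO: "finite O1" using F by (simp add: O1_def)
  have "card F = (\<Sum>A\<in>O1. card A)"
  proof -
    have "finite A" if "A \<in> O1" for A using that U F(1) by (meson Union_upper finite_subset)
    then show ?thesis
      using card_Union_disjoint[of O1] disj U by (simp add: pairwise_def disjnt_def)
  qed
  also have "\<dots> = card {x0} + (\<Sum>A\<in>O1 - {{x0}}. card A)"
  proof -
    have "orbit G \<phi> x0 = {x0}"
      using x0 self by (auto simp: orbit_def)
    then have "{x0} \<in> O1" using x0 by (auto simp: O1_def)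
    then show ?thesis using sum.remove[OF fO, of "{x0}" card] by simp
  qed
  finally have eq: "card F = 1 + (\<Sum>A\<in>O1 - {{x0}}. card A)" by simp
  have "p dvd card A" if A: "A \<in> O1 - {{x0}}" for A
  proof -
    obtain x where x: "x \<in> F" "A = orbit G \<phi> x" using A by (auto simp: O1_def)
    have "card A dvd p ^ n"
      using orbit_stabilizer_theorem[of x] x F(2) ord by (metis dvd_triv_left subsetD)
    then obtain k where k: "card A = p ^ k"
      using divides_primepow_nat[OF p] by blast
    \<comment> \<open>An orbit of length 1 is a fixed point, hence \<open>x0\<close> by the
      assumption for contradiction, but the orbit of \<open>x0\<close> has been taken out of the
      sum.\<close>
    have "k \<noteq> 0"
    proof
      assume "k = 0"
      then have "card A = 1" using k by simp
      then have Ax: "A = {x}" using self[OF x(1)] x(2) by (metis card_1_singletonE singletonD)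
      then have "\<forall>g\<in>carrier G. \<phi> g x = x" using x(2) by (auto simp: orbit_def)
      then have "x = x0" using no x(1) by blast
      then show False using A Ax by blast
    qed
    then show ?thesis using k by simp
  qed
  then have "p dvd (\<Sum>A\<in>O1 - {{x0}}. card A)" by (rule dvd_sum)
  then have "p dvd 1" using dvd unfolding eq by (simp only: dvd_add_left_iff)
  then show False using p by (simp add: prime_nat_iff)
qed

context group
begin

abbreviation commutator :: "'a \<Rightarrow> 'a \<Rightarrow> 'a"
  where "commutator a b \<equiv> inv a \<otimes> inv b \<otimes> a \<otimes> b"

text \<open>Once \<open>m_assoc\<close> has bracketed a word to the right, these rules let
  \<open>simp\<close> cancel neighbouring inverses inside it.\<close>

lemma inv_cancel [simp]:
  assumes "a \<in> carrier G" "b \<in> carrier G"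
  shows "inv a \<otimes> (a \<otimes> b) = b" and "a \<otimes> (inv a \<otimes> b) = b"
  using assms by (simp_all add: m_assoc[symmetric])

lemma subgroup_card_prime_power:
  assumes p: "Factorial_Ring.prime p" and G: "p_group G p" and H: "subgroup H G"
  obtains k where "card H = p ^ k"
proof -
  obtain n where "card (carrier G) = p ^ n" using G by (auto simp: p_group_def)
  then have "card H dvd p ^ n"
    using lagrange[OF H] unfolding order_def by (metis dvd_triv_right)
  then show ?thesis using divides_primepow_nat[OF p] that by blast
qed

text \<open>\<open>P\<close> acts by conjugation on the right cosets of \<open>N\<close> in
  \<open>K\<close>. Their number is a power of \<open>p\<close> other than 1, and \<open>N\<close>
  itself is fixed, so a second coset is fixed; it supplies \<open>z\<close>. The result replaces the
  use of central elements in a quotient.\<close>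

lemma ex_fixed_mod_subgroup:
  assumes p: "Factorial_Ring.prime p" and G: "p_group G p"
    and P: "subgroup P G" and K: "subgroup K G" and N: "subgroup N G" and NK: "N \<subset> K"
    and PK: "\<And>s k. s \<in> P \<Longrightarrow> k \<in> K \<Longrightarrow> s \<otimes> k \<otimes> inv s \<in> K"
    and PN: "\<And>s k. s \<in> P \<Longrightarrow> k \<in> N \<Longrightarrow> s \<otimes> k \<otimes> inv s \<in> N"
  obtains z where "z \<in> K" "z \<notin> N" "\<And>s. s \<in> P \<Longrightarrow> inv z \<otimes> inv s \<otimes> z \<otimes> s \<in> N"
proof -
  have fin: "finite (carrier G)" using G by (simp add: p_group_def)
  have [simp]: "k \<in> K \<Longrightarrow> k \<in> carrier G" "k \<in> N \<Longrightarrow> k \<in> carrier G" "k \<in> P \<Longrightarrow> k \<in> carrier G" for k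
    by (simp_all add: subgroup.mem_carrier[OF K] subgroup.mem_carrier[OF N] subgroup.mem_carrier[OF P])
  have Ncar: "N \<subseteq> carrier G" using N by (rule subgroup.subset)
  define F where "F = (\<lambda>x. N #> x) ` K"
  let ?GK = "G\<lparr>carrier := K\<rparr>" and ?GP = "G\<lparr>carrier := P\<rparr>"
  \<comment> \<open>This is the conjugation action on all subsets of the group, restricted to
    \<open>P\<close>; the cosets in \<open>F\<close> are an invariant part of it.\<close>
  let ?phi = "\<lambda>g. \<lambda>H \<in> {H. H \<subseteq> carrier G}. g <# H #> inv g"
  have rc: "rcosets\<^bsub>?GK\<^esub> N = F" unfolding F_def RCOSETS_def r_coset_def by auto
  interpret GK: group ?GK using K subgroup_imp_group by blast
  have "subgroup N ?GK" using N K NK subgroup_incl by blast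
  then have cF: "card F * card N = card K"
    using GK.lagrange[of N] rc by (simp add: order_def)
  obtain k where k: "card K = p ^ k" using subgroup_card_prime_power[OF p G K] .
  have fK: "finite K" using fin finite_subset[OF subgroup.subset[OF K]] by blast
  have "card F dvd p ^ k" using cF k by (metis dvd_triv_left)
  then obtain j where j: "card F = p ^ j" using divides_primepow_nat[OF p] by blast
  have "card F \<noteq> 1" using cF psubset_card_mono[OF fK NK] by auto
  then have "j \<noteq> 0" using j by auto
  then have dvd: "p dvd card F" using j by simp
  obtain n where n: "card P = p ^ n" using subgroup_card_prime_power[OF p G P] .
  interpret A: group_action ?GP "{H. H \<subseteq> carrier G}" ?phi
    using group_action.induced_action[OF action_by_conjugation_on_power_set P] .
  have FC: "F \<subseteq> {H. H \<subseteq> carrier G}"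
    using Ncar by (auto simp: F_def r_coset_def)
  have coset: "s <# (N #> x) #> inv s = N #> (s \<otimes> x \<otimes> inv s)" if s: "s \<in> P" and x: "x \<in> K" for s x
  proof (intro equalityI subsetI)
    fix y assume "y \<in> s <# (N #> x) #> inv s"
    then obtain m where m: "m \<in> N" "y = s \<otimes> (m \<otimes> x) \<otimes> inv s"
      by (auto simp: r_coset_def l_coset_def)
    have "y = (s \<otimes> m \<otimes> inv s) \<otimes> (s \<otimes> x \<otimes> inv s)" using m s x by (simp add: m_assoc)
    then show "y \<in> N #> (s \<otimes> x \<otimes> inv s)" using PN[OF s m(1)] by (auto simp: r_coset_def)
  next
    fix y assume "y \<in> N #> (s \<otimes> x \<otimes> inv s)"
    then obtain m where m: "m \<in> N" "y = m \<otimes> (s \<otimes> x \<otimes> inv s)" by (auto simp: r_coset_def)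
    have "inv s \<otimes> m \<otimes> s \<in> N" using PN[of "inv s" m] s m P by (simp add: subgroup.m_inv_closed)
    moreover have "y = s \<otimes> ((inv s \<otimes> m \<otimes> s) \<otimes> x) \<otimes> inv s" using m s x by (simp add: m_assoc)
    ultimately show "y \<in> s <# (N #> x) #> inv s" unfolding r_coset_def l_coset_def by auto
  qed
  have N1: "N #> \<one> = N" using Ncar by simp
  have "\<exists>x\<in>F. x \<noteq> N \<and> (\<forall>g\<in>carrier ?GP. ?phi g x = x)"
  proof (rule A.ex_second_fixed_point[OF p])
    show "order ?GP = p ^ n" using n by (simp add: order_def)
    show "finite F" using fK by (simp add: F_def)
    show "F \<subseteq> {H. H \<subseteq> carrier G}" by (rule FC)
    show "p dvd card F" by (rule dvd)
    show NF: "N \<in> F" using N1 subgroup.one_closed[OF K] by (force simp: F_def)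
    fix g assume g: "g \<in> carrier ?GP"
    show "?phi g x \<in> F" if "x \<in> F" for x
      using that g FC coset PK by (auto simp: F_def)
    have "?phi g N = g <# (N #> \<one>) #> inv g" using Ncar N1 by simp
    also have "\<dots> = N" using coset[of g \<one>] g subgroup.one_closed[OF K] N1 by simp
    finally show "?phi g N = N" .
  qed
  then obtain z where z: "z \<in> K" "N #> z \<noteq> N" "\<And>s. s \<in> P \<Longrightarrow> ?phi s (N #> z) = N #> z"
    by (auto simp: F_def)
  have zN: "z \<notin> N" using z coset_join2[OF _ N] by auto
  \<comment> \<open>With right cosets, fixedness of \<open>N #> z\<close> under \<open>inv s\<close>
    bounds the commutator of \<open>inv z\<close>, not of \<open>z\<close>, with \<open>s\<close>.
    Hence the final witness is \<open>inv z\<close>.\<close>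
  have "inv (inv z) \<otimes> inv s \<otimes> inv z \<otimes> s \<in> N" if s: "s \<in> P" for s
  proof -
    let ?t = "inv s"
    have t: "?t \<in> P" using s P by (simp add: subgroup.m_inv_closed)
    have "N #> (?t \<otimes> z \<otimes> inv ?t) = N #> z"
      using z(3)[OF t] coset[OF t z(1)] FC z(1) by (auto simp: F_def)
    then have "?t \<otimes> z \<otimes> inv ?t \<in> N #> z"
      using t z(1) s by (metis N \<open>\<And>k. k \<in> K \<Longrightarrow> k \<in> carrier G\<close> PK rcos_self)
    then obtain m where m: "m \<in> N" "?t \<otimes> z \<otimes> s = m \<otimes> z" using s by (auto simp: r_coset_def)
    have "z \<otimes> ?t \<otimes> inv z \<otimes> s = inv m"
    proof -
      have "m = ?t \<otimes> z \<otimes> s \<otimes> inv z" using m s z(1) by (simp add: m_assoc)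
      then show ?thesis using s z(1) by (simp add: m_assoc inv_mult_group)
    qed
    then show ?thesis using m N z(1) by (simp add: subgroup.m_inv_closed)
  qed
  moreover have "inv z \<in> K" using z(1) K by (simp add: subgroup.m_inv_closed)
  moreover have "inv z \<notin> N" using zN N z(1) subgroup.m_inv_closed[of N G "inv z"] by auto
  ultimately show ?thesis using that by blast
qed


section \<open>Centralizers, iterated commutators and \<open>Omega1\<close>\<close>

lemma centralizer_subset_carrier: "centralizer G Q \<subseteq> carrier G"
  by (auto simp: centralizer_def)

lemma centralizer_antimono: "Q \<subseteq> R \<Longrightarrow> centralizer G R \<subseteq> centralizer G Q"
  by (auto simp: centralizer_def)

lemma subgroup_centralizer:
  assumes "Q \<subseteq> carrier G"
  shows "subgroup (centralizer G Q) G"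
proof (rule subgroupI)
  show "centralizer G Q \<subseteq> carrier G" by (rule centralizer_subset_carrier)
  show "centralizer G Q \<noteq> {}"
    using assms by (auto simp: centralizer_def intro!: exI[of _ \<one>])
next
  fix a assume a: "a \<in> centralizer G Q"
  have "inv a \<otimes> q = q \<otimes> inv a" if q: "q \<in> Q" for q
  proof -
    have [simp]: "a \<in> carrier G" "q \<in> carrier G" and c: "a \<otimes> q = q \<otimes> a"
      using a q assms by (auto simp: centralizer_def)
    have "inv a \<otimes> q = inv a \<otimes> (q \<otimes> a) \<otimes> inv a" by (simp add: m_assoc)
    also have "\<dots> = q \<otimes> inv a" by (simp add: c[symmetric])
    finally show ?thesis .
  qed
  then show "inv a \<in> centralizer G Q" using a by (auto simp: centralizer_def)
next
  fix a b assume a: "a \<in> centralizer G Q" and b: "b \<in> centralizer G Q"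
  have "a \<otimes> b \<otimes> q = q \<otimes> (a \<otimes> b)" if q: "q \<in> Q" for q
  proof -
    have [simp]: "a \<in> carrier G" "b \<in> carrier G" "q \<in> carrier G"
      and c: "a \<otimes> q = q \<otimes> a" "b \<otimes> q = q \<otimes> b"
      using a b q assms by (auto simp: centralizer_def)
    have "a \<otimes> b \<otimes> q = a \<otimes> q \<otimes> b" by (simp add: m_assoc c(2))
    also have "\<dots> = q \<otimes> (a \<otimes> b)" unfolding c(1) by (simp add: m_assoc)
    finally show ?thesis .
  qed
  then show "a \<otimes> b \<in> centralizer G Q" using a b by (auto simp: centralizer_def)
qed

lemma normal_centralizer:
  assumes Q: "Q \<lhd> G"
  shows "centralizer G Q \<lhd> G"
  unfolding normal_inv_iff
proof (intro conjI ballI)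
  have Qs: "Q \<subseteq> carrier G" using Q by (simp add: normal_imp_subgroup subgroup.subset)
  then show "subgroup (centralizer G Q) G" by (rule subgroup_centralizer)
  fix x c assume x [simp]: "x \<in> carrier G" and c: "c \<in> centralizer G Q"
  have [simp]: "c \<in> carrier G" using c by (simp add: centralizer_def)
  have "x \<otimes> c \<otimes> inv x \<otimes> q = q \<otimes> (x \<otimes> c \<otimes> inv x)" if q: "q \<in> Q" for q
  proof -
    have [simp]: "q \<in> carrier G" using q Qs by blast
    have "inv x \<otimes> q \<otimes> x \<in> Q" using normal.inv_op_closed1[OF Q x q] .
    then have "c \<otimes> (inv x \<otimes> q \<otimes> x) = inv x \<otimes> q \<otimes> x \<otimes> c"
      using c by (auto simp: centralizer_def)
    then have "x \<otimes> (c \<otimes> (inv x \<otimes> q \<otimes> x)) \<otimes> inv x = x \<otimes> (inv x \<otimes> q \<otimes> x \<otimes> c) \<otimes> inv x"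
      by simp
    then show ?thesis by (simp add: m_assoc)
  qed
  then show "x \<otimes> c \<otimes> inv x \<in> centralizer G Q" by (auto simp: centralizer_def)
qed

lemma commutator_mem_normal:
  assumes N: "N \<lhd> G" and a: "a \<in> carrier G" and b: "b \<in> carrier G" and ab: "a \<in> N \<or> b \<in> N"
  shows "inv a \<otimes> inv b \<otimes> a \<otimes> b \<in> N"
  using ab
proof
  have N': "subgroup N G" using N by (rule normal_imp_subgroup)
  show ?thesis if "a \<in> N"
  proof -
    have "inv a \<otimes> (inv b \<otimes> a \<otimes> b) \<in> N"
      using that N' normal.inv_op_closed1[OF N b that]
      by (simp add: subgroup.m_closed subgroup.m_inv_closed)
    then show ?thesis using a b by (simp add: m_assoc)
  qed
  show ?thesis if "b \<in> N"
  proof -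
    have "(inv a \<otimes> inv b \<otimes> a) \<otimes> b \<in> N"
      using that N' normal.inv_op_closed1[OF N a, of "inv b"]
      by (simp add: subgroup.m_closed subgroup.m_inv_closed)
    then show ?thesis .
  qed
qed

lemma comm_subgroup_mono: "A \<subseteq> A' \<Longrightarrow> comm_subgroup G A B \<subseteq> comm_subgroup G A' B"
  unfolding comm_subgroup_def by (rule mono_generate) blast

lemma comm_subgroup_subset:
  assumes "subgroup H G" and "\<And>a b. a \<in> A \<Longrightarrow> b \<in> B \<Longrightarrow> inv a \<otimes> inv b \<otimes> a \<otimes> b \<in> H"
  shows "comm_subgroup G A B \<subseteq> H"
  unfolding comm_subgroup_def using assms by (intro generate_subgroup_incl) blast+

lemma iter_comm_mono: "A \<subseteq> A' \<Longrightarrow> iter_comm G A B k \<subseteq> iter_comm G A' B k"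
  by (induction k) (simp_all add: comm_subgroup_mono)

lemma one_mem_iter_comm: "k > 0 \<Longrightarrow> \<one> \<in> iter_comm G A B k"
  by (cases k) (auto simp: comm_subgroup_def intro: generate.one)

lemma iter_comm_set_mult:
  assumes K: "K \<lhd> G" and A: "A \<subseteq> centralizer G K" and Q: "Q \<subseteq> carrier G"
  shows "iter_comm G A (K <#> Q) k \<subseteq> iter_comm G A Q k \<and> iter_comm G A Q k \<subseteq> centralizer G K"
proof (induction k)
  case 0
  then show ?case using A by simp
next
  case (Suc k)
  have C: "centralizer G K \<lhd> G" using K by (rule normal_centralizer)
  have Ks: "K \<subseteq> carrier G" using K by (simp add: normal_imp_subgroup subgroup.subset)
  have eq: "inv a \<otimes> inv (x \<otimes> q) \<otimes> a \<otimes> (x \<otimes> q) = inv a \<otimes> inv q \<otimes> a \<otimes> q"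
    if a: "a \<in> centralizer G K" and x: "x \<in> K" and q: "q \<in> Q" for a x q
  proof -
    have [simp]: "a \<in> carrier G" "x \<in> carrier G" "q \<in> carrier G" and c: "a \<otimes> x = x \<otimes> a"
      using a x q Q Ks by (auto simp: centralizer_def)
    have "inv a \<otimes> inv (x \<otimes> q) \<otimes> a \<otimes> (x \<otimes> q) = inv a \<otimes> inv q \<otimes> inv x \<otimes> (a \<otimes> x) \<otimes> q"
      by (simp add: m_assoc inv_mult_group)
    also have "\<dots> = inv a \<otimes> inv q \<otimes> a \<otimes> q" unfolding c by (simp add: m_assoc)
    finally show ?thesis .
  qed
  have "comm_subgroup G (iter_comm G A (K <#> Q) k) (K <#> Q) \<subseteq>
      comm_subgroup G (iter_comm G A Q k) (K <#> Q)"
    using Suc by (intro comm_subgroup_mono) simp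
  also have "\<dots> \<subseteq> comm_subgroup G (iter_comm G A Q k) Q"
    unfolding comm_subgroup_def
  proof (rule mono_generate, safe)
    fix a b assume a: "a \<in> iter_comm G A Q k" and "b \<in> K <#> Q"
    then obtain x q where xq: "x \<in> K" "q \<in> Q" "b = x \<otimes> q" by (auto simp: set_mult_def)
    have "inv a \<otimes> inv b \<otimes> a \<otimes> b = inv a \<otimes> inv q \<otimes> a \<otimes> q"
      using eq[of a x q] a xq Suc by auto
    then show "\<exists>a' b'. inv a \<otimes> inv b \<otimes> a \<otimes> b = inv a' \<otimes> inv b' \<otimes> a' \<otimes> b' \<and> a' \<in> iter_comm G A Q k \<and> b' \<in> Q"
      using a xq(2) by blast
  qed
  finally have 1: "iter_comm G A (K <#> Q) (Suc k) \<subseteq> iter_comm G A Q (Suc k)" by simp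
  have "comm_subgroup G (iter_comm G A Q k) Q \<subseteq> centralizer G K"
  proof (rule comm_subgroup_subset[OF normal_imp_subgroup[OF C]])
    fix a b assume "a \<in> iter_comm G A Q k" "b \<in> Q"
    then show "inv a \<otimes> inv b \<otimes> a \<otimes> b \<in> centralizer G K"
      using commutator_mem_normal[OF C] Suc Q centralizer_subset_carrier by blast
  qed
  then show ?case using 1 by simp
qed

text \<open>The first commutator lies in \<open>H\<close>, and \<open>B\<close> centralizes
  \<open>H\<close>, so the second is trivial and stays so. For an odd prime the exponent
  \<open>p - 1\<close> has this form.\<close>

lemma iter_comm_eq_one_Suc_Suc:
  assumes A: "A \<subseteq> carrier G" and B: "B \<subseteq> carrier G"
    and H: "subgroup H G"
    and AB: "\<And>a b. a \<in> A \<Longrightarrow> b \<in> B \<Longrightarrow> inv a \<otimes> inv b \<otimes> a \<otimes> b \<in> H"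
    and HB: "\<And>h b. h \<in> H \<Longrightarrow> b \<in> B \<Longrightarrow> h \<otimes> b = b \<otimes> h"
  shows "iter_comm G A B (Suc (Suc k)) = {\<one>}"
proof -
  have triv: "comm_subgroup G A' B \<subseteq> {\<one>}" if "A' \<subseteq> H" for A'
  proof (rule comm_subgroup_subset[OF triv_subgroup])
    fix a b assume "a \<in> A'" and b: "b \<in> B"
    then have a: "a \<in> H" using that by blast
    then have [simp]: "a \<in> carrier G" "b \<in> carrier G"
      using b B subgroup.mem_carrier[OF H] by auto
    have "inv a \<otimes> inv b \<otimes> a \<otimes> b = inv a \<otimes> inv b \<otimes> (a \<otimes> b)" by (simp add: m_assoc)
    also have "\<dots> = \<one>" unfolding HB[OF a b] by (simp add: m_assoc)
    finally show "inv a \<otimes> inv b \<otimes> a \<otimes> b \<in> {\<one>}" by simp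
  qed
  have "iter_comm G A B (Suc k) \<subseteq> H" for k
  proof (induction k)
    case 0
    show ?case using comm_subgroup_subset[OF H AB] by simp
  next
    case (Suc k)
    then have "iter_comm G A B (Suc (Suc k)) \<subseteq> {\<one>}" using triv by simp
    then show ?case using subgroup.one_closed[OF H] by blast
  qed
  then have "iter_comm G A B (Suc (Suc k)) \<subseteq> {\<one>}" using triv by simp
  then show ?thesis using one_mem_iter_comm[of "Suc (Suc k)"] by blast
qed

lemma Omega1_subset:
  "subgroup H G \<Longrightarrow> {x \<in> A. ord x = p} \<subseteq> H \<Longrightarrow> Omega1 G p A \<subseteq> H"
  unfolding Omega1_def by (intro generate_subgroup_incl)

lemma Omega1_mono: "A \<subseteq> B \<Longrightarrow> Omega1 G p A \<subseteq> Omega1 G p B"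
  unfolding Omega1_def by (rule mono_generate) blast

section \<open>Existence and maximality of the Oliver subgroup\<close>

lemma oliver_admissible_one: "oliver_admissible G p {\<one>}"
  unfolding oliver_admissible_def
  using one_is_normal by (intro conjI exI[of _ "0::nat"] exI[of _ "\<lambda>_. {\<one>}"]) simp_all

lemma oliver_admissible_extend:
  assumes K: "oliver_admissible G p K" and L: "L \<lhd> G" "K \<subseteq> L"
    and c: "iter_comm G (Omega1 G p (centralizer G K)) L (p - 1) = {\<one>}"
  shows "oliver_admissible G p L"
proof -
  obtain n :: nat and Q where Q: "Q 0 = {\<one>}" "Q n = K" "\<forall>i\<le>n. Q i \<lhd> G"
    "\<forall>i\<in>{1..n}. Q (i - 1) \<subseteq> Q i \<and>
           iter_comm G (Omega1 G p (centralizer G (Q (i - 1)))) (Q i) (p - 1) = {\<one>}"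
    using K unfolding oliver_admissible_def by blast
  let ?R = "Q(Suc n := L)"
  have "?R (i - 1) \<subseteq> ?R i \<and>
           iter_comm G (Omega1 G p (centralizer G (?R (i - 1)))) (?R i) (p - 1) = {\<one>}"
    if "i \<in> {1..Suc n}" for i
  proof (cases "i = Suc n")
    case True
    then show ?thesis using Q(2) L c by simp
  next
    case False
    then have "i \<in> {1..n}" "i - 1 \<noteq> Suc n" using that by auto
    then show ?thesis using bspec[OF Q(4)] False by simp
  qed
  moreover have "?R 0 = {\<one>}" "?R (Suc n) = L" "\<forall>i\<le>Suc n. ?R i \<lhd> G"
    using Q(1,3) L(1) by (simp_all add: le_Suc_eq)
  ultimately show ?thesis unfolding oliver_admissible_def using L(1) by blast
qed

text \<open>Multiplying the chain of \<open>L\<close> by \<open>K\<close> gives terms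
  \<open>K <#> Q i\<close> that continue a chain of \<open>K\<close>. The centralizer of such a term
  lies in that of \<open>Q i\<close>, so the condition from the chain of \<open>L\<close> applies,
  and in that of \<open>K\<close>, so the factor \<open>K\<close> does not change the
  commutators.\<close>

lemma oliver_admissible_set_mult:
  assumes p: "p > 1" and K: "oliver_admissible G p K" and L: "oliver_admissible G p L"
  shows "oliver_admissible G p (K <#> L)"
proof -
  have Kn: "K \<lhd> G" using K by (simp add: oliver_admissible_def)
  have Ks: "K \<subseteq> carrier G" using Kn by (simp add: normal_imp_subgroup subgroup.subset)
  obtain n :: nat and Q where Q: "Q 0 = {\<one>}" "Q n = L" "\<And>i. i \<le> n \<Longrightarrow> Q i \<lhd> G"
    "\<And>i. i \<in> {1..n} \<Longrightarrow> Q (i - 1) \<subseteq> Q i \<and>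
           iter_comm G (Omega1 G p (centralizer G (Q (i - 1)))) (Q i) (p - 1) = {\<one>}"
    using L unfolding oliver_admissible_def by blast
  have "oliver_admissible G p (K <#> Q i)" if "i \<le> n" for i
    using that
  proof (induction i)
    case 0
    have "K <#> {\<one>} = K" using Ks by (force simp: set_mult_def)
    then show ?case using K Q(1) by simp
  next
    case (Suc i)
    let ?V = "Omega1 G p (centralizer G (K <#> Q i))"
    have Qi: "Q i \<lhd> G" "Q (Suc i) \<lhd> G" using Q(3) Suc.prems by auto
    have Qs: "Q i \<subseteq> carrier G" "Q (Suc i) \<subseteq> carrier G" "\<one> \<in> Q i"
      using Qi[THEN normal_imp_subgroup] by (simp_all add: subgroup.subset subgroup.one_closed)
    have step: "Q i \<subseteq> Q (Suc i)"
      "iter_comm G (Omega1 G p (centralizer G (Q i))) (Q (Suc i)) (p - 1) = {\<one>}"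
      using Q(4)[of "Suc i"] Suc.prems by auto
    have one: "\<one> \<in> K" using Kn by (simp add: normal_imp_subgroup subgroup.one_closed)
    have KsubKQ: "K \<subseteq> K <#> Q i" using Qs(3) Ks by (force simp: set_mult_def)
    have "Q i \<subseteq> K <#> Q i" using one Qs(1) by (force simp: set_mult_def)
    then have V2: "?V \<subseteq> Omega1 G p (centralizer G (Q i))"
      by (intro Omega1_mono centralizer_antimono)
    have V1: "?V \<subseteq> centralizer G K"
      using Omega1_subset[OF subgroup_centralizer[OF Ks]] centralizer_antimono[OF KsubKQ] by blast
    have "iter_comm G ?V (K <#> Q (Suc i)) (p - 1) \<subseteq> iter_comm G ?V (Q (Suc i)) (p - 1)"
      using iter_comm_set_mult[OF Kn V1 Qs(2)] by blast
    also have "\<dots> \<subseteq> {\<one>}" using iter_comm_mono[OF V2] step(2) by blast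
    finally have "iter_comm G ?V (K <#> Q (Suc i)) (p - 1) = {\<one>}"
      using one_mem_iter_comm[of "p - 1"] p by fastforce
    moreover have "K <#> Q i \<subseteq> K <#> Q (Suc i)" using step(1) by (auto simp: set_mult_def)
    ultimately show ?case
      using oliver_admissible_extend Suc normal_subgroup_set_mult_closed[OF Kn Qi(2)] by simp
  qed
  then show ?thesis using Q(2) by blast
qed

text \<open>Shows that the definite description is meaningful: finiteness gives a maximal admissible
  subgroup, and closure under products makes it the greatest one.\<close>

lemma oliver_subgroup_greatest:
  assumes p: "p > 1" and fin: "finite (carrier G)"
  shows "oliver_admissible G p (oliver_subgroup G p)"
    and "oliver_admissible G p L \<Longrightarrow> L \<subseteq> oliver_subgroup G p"
proof -
  let ?A = "{K. oliver_admissible G p K}"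
  have sub: "K \<subseteq> carrier G" if "K \<in> ?A" for K
    using that by (simp add: oliver_admissible_def normal_imp_subgroup subgroup.subset)
  then have "finite ?A" using fin by (intro finite_subset[of ?A "Pow (carrier G)"]) auto
  then obtain K where K: "K \<in> ?A" "\<And>L. L \<in> ?A \<Longrightarrow> K \<subseteq> L \<Longrightarrow> L = K"
    using finite_has_maximal[of ?A] oliver_admissible_one by (metis (no_types, lifting) empty_iff mem_Collect_eq)
  have max: "L \<subseteq> K" if L: "oliver_admissible G p L" for L
  proof -
    have "\<one> \<in> K" "\<one> \<in> L"
      using L K(1) by (simp_all add: oliver_admissible_def normal_imp_subgroup subgroup.one_closed)
    then have "K \<subseteq> K <#> L" "L \<subseteq> K <#> L"
      using sub[OF K(1)] sub[of L] L by (force simp: set_mult_def)+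
    moreover have "K <#> L \<in> ?A" using oliver_admissible_set_mult[OF p] K(1) L by simp
    ultimately show ?thesis using K(2) by blast
  qed
  have "oliver_subgroup G p = K"
    unfolding oliver_subgroup_def using K(1) max by (intro the_equality) auto
  then show "oliver_admissible G p (oliver_subgroup G p)"
    and "oliver_admissible G p L \<Longrightarrow> L \<subseteq> oliver_subgroup G p"
    using K(1) max by auto
qed

text \<open>The form in which maximality is used later: an admissible one-step extension of the
  Oliver subgroup adds nothing.\<close>

lemma subset_oliver_subgroup:
  assumes "p > 1" and "finite (carrier G)" and "L \<lhd> G" and "oliver_subgroup G p \<subseteq> L"
    and "iter_comm G (Omega1 G p (centralizer G (oliver_subgroup G p))) L (p - 1) = {\<one>}"
  shows "L \<subseteq> oliver_subgroup G p"
  using assms oliver_admissible_extend oliver_subgroup_greatest by blast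


section \<open>The Oliver subgroup contains its centralizer\<close>

text \<open>The set is the preimage of the centre of the quotient by \<open>U\<close>, written with
  commutators so that no quotient group has to be formed.\<close>

lemma normal_central_mod:
  assumes U: "U \<lhd> G"
  shows "{q \<in> carrier G. \<forall>s\<in>carrier G. commutator q s \<in> U} \<lhd> G" (is "?T \<lhd> G")
  unfolding normal_inv_iff
proof (intro conjI ballI)
  have Xs: "subgroup U G" using U by (rule normal_imp_subgroup)
  show "subgroup ?T G"
  proof (rule subgroupI)
    show "?T \<subseteq> carrier G" by blast
    show "?T \<noteq> {}" using subgroup.one_closed[OF Xs] by (auto intro!: exI[of _ \<one>])
  next
    fix q assume q: "q \<in> ?T"
    have "commutator (inv q) s \<in> U" if s: "s \<in> carrier G" for s
    proof -
      have "q \<otimes> inv (commutator q s) \<otimes> inv q \<in> U"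
        using q s U Xs by (simp add: normal.inv_op_closed2 subgroup.m_inv_closed)
      moreover have "q \<otimes> inv (commutator q s) \<otimes> inv q = commutator (inv q) s"
        using q s by (simp add: m_assoc inv_mult_group)
      ultimately show ?thesis by simp
    qed
    then show "inv q \<in> ?T" using q by simp
  next
    fix q r assume q: "q \<in> ?T" and r: "r \<in> ?T"
    have "commutator (q \<otimes> r) s \<in> U" if s: "s \<in> carrier G" for s
    proof -
      have "inv r \<otimes> commutator q s \<otimes> r \<otimes> commutator r s \<in> U"
        using q r s U Xs by (simp add: normal.inv_op_closed1 subgroup.m_closed)
      moreover have "inv r \<otimes> commutator q s \<otimes> r \<otimes> commutator r s = commutator (q \<otimes> r) s"
        using q r s by (simp add: m_assoc inv_mult_group)
      ultimately show ?thesis by simp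
    qed
    then show "q \<otimes> r \<in> ?T" using q r by simp
  qed
  fix x q assume x: "x \<in> carrier G" and q: "q \<in> ?T"
  have "commutator (x \<otimes> q \<otimes> inv x) s \<in> U" if s: "s \<in> carrier G" for s
  proof -
    let ?s = "inv x \<otimes> s \<otimes> x"
    have "x \<otimes> commutator q ?s \<otimes> inv x \<in> U"
      using q s x U by (simp add: normal.inv_op_closed2)
    moreover have "x \<otimes> commutator q ?s \<otimes> inv x = commutator (x \<otimes> q \<otimes> inv x) s"
      using q s x by (simp add: m_assoc inv_mult_group)
    ultimately show ?thesis by simp
  qed
  then show "x \<otimes> q \<otimes> inv x \<in> ?T" using q x by simp
qed

text \<open>If \<open>C\<close> were not inside \<open>U\<close>, it would contain some
  \<open>z\<close> outside \<open>U\<close> that is central modulo \<open>U\<close>. With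
  \<open>T\<close> the preimage of the centre modulo \<open>U\<close>, commutators of
  \<open>Omega1 G p C\<close> with \<open>T \<inter> C\<close> fall into
  \<open>U \<inter> C\<close>, which \<open>C\<close> centralizes. Two commutators thus suffice, and
  \<open>U <#> (T \<inter> C)\<close> is an admissible group containing \<open>z\<close>.\<close>

lemma centralizer_oliver_subset:
  assumes p: "Factorial_Ring.prime p" "odd p" and G: "p_group G p"
  shows "centralizer G (oliver_subgroup G p) \<subseteq> oliver_subgroup G p"
proof (rule ccontr)
  define U where "U = oliver_subgroup G p"
  define C where "C = centralizer G U"
  define T where "T = {q \<in> carrier G. \<forall>s\<in>carrier G. commutator q s \<in> U}"
  assume "\<not> ?thesis"
  then have nCX: "\<not> C \<subseteq> U" by (simp add: U_def C_def)
  have fin: "finite (carrier G)" using G by (simp add: p_group_def)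
  have p1: "p > 1" using p(1) by (rule prime_gt_1_nat)
  have U: "U \<lhd> G"
    using oliver_subgroup_greatest(1)[OF p1 fin] by (simp add: U_def oliver_admissible_def)
  have C: "C \<lhd> G" using normal_centralizer[OF U] by (simp add: C_def)
  have T: "T \<lhd> G" using normal_central_mod[OF U] by (simp add: T_def)
  have XC: "U \<inter> C \<lhd> G" and TC: "T \<inter> C \<lhd> G" using normal_subgroup_intersect U C T by auto
  have Cc: "C \<subseteq> carrier G" unfolding C_def by (rule centralizer_subset_carrier)
  have Xc: "U \<subseteq> carrier G" using U by (simp add: normal_imp_subgroup subgroup.subset)
  obtain z where z: "z \<in> C" "z \<notin> U \<inter> C" "\<And>s. s \<in> carrier G \<Longrightarrow> commutator z s \<in> U \<inter> C"
  proof (rule ex_fixed_mod_subgroup[OF p(1) G subgroup_self normal_imp_subgroup[OF C] normal_imp_subgroup[OF XC]])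
    show "U \<inter> C \<subset> C" using nCX by blast
  qed (use normal.inv_op_closed2[OF C] normal.inv_op_closed2[OF XC] in blast)+
  then have zT: "z \<in> T \<inter> C" using Cc by (auto simp: T_def)
  let ?V = "Omega1 G p C"
  have V: "?V \<subseteq> C" by (rule Omega1_subset[OF normal_imp_subgroup[OF C]]) blast
  \<comment> \<open>The exponent is \<open>p - 1\<close>: an odd prime is at least 3, so the
    subtraction does not truncate.\<close>
  have "iter_comm G ?V (T \<inter> C) (Suc (Suc (p - 3))) = {\<one>}"
  proof (rule iter_comm_eq_one_Suc_Suc[OF _ _ normal_imp_subgroup[OF XC]])
    show "?V \<subseteq> carrier G" "T \<inter> C \<subseteq> carrier G" using V Cc by auto
    show "h \<otimes> b = b \<otimes> h" if "h \<in> U \<inter> C" "b \<in> T \<inter> C" for h b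
      using that by (auto simp: C_def centralizer_def)
    fix a b assume a: "a \<in> ?V" and b: "b \<in> T \<inter> C"
    have [simp]: "a \<in> carrier G" "b \<in> carrier G" and "a \<in> C" using a b V Cc by auto
    have "inv (commutator b a) \<in> U"
      using b normal_imp_subgroup[OF U] by (simp add: T_def subgroup.m_inv_closed)
    moreover have "inv (commutator b a) = commutator a b" by (simp add: m_assoc inv_mult_group)
    ultimately show "commutator a b \<in> U \<inter> C"
      using commutator_mem_normal[OF C, of a b] \<open>a \<in> C\<close> by simp
  qed
  moreover have p3: "Suc (Suc (p - 3)) = p - 1"
    using p1 p(2) by (cases "p = 2") auto
  moreover have "iter_comm G ?V (U <#> (T \<inter> C)) (p - 1) \<subseteq> iter_comm G ?V (T \<inter> C) (p - 1)"
    using iter_comm_set_mult[OF U, of ?V "T \<inter> C"] V Cc by (auto simp: C_def)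
  ultimately have "iter_comm G ?V (U <#> (T \<inter> C)) (p - 1) = {\<one>}"
    using one_mem_iter_comm[of "p - 1" ?V "U <#> (T \<inter> C)"] p1 by auto
  moreover have "U \<subseteq> U <#> (T \<inter> C)"
    using Xc normal_imp_subgroup[OF TC, THEN subgroup.one_closed] by (force simp: set_mult_def)
  ultimately have "U <#> (T \<inter> C) \<subseteq> U"
    using subset_oliver_subgroup[OF p1 fin normal_subgroup_set_mult_closed[OF U TC]]
    by (simp add: U_def C_def)
  moreover have "z \<in> U <#> (T \<inter> C)"
    using zT Cc normal_imp_subgroup[OF U, THEN subgroup.one_closed] by (force simp: set_mult_def)
  ultimately show False using z by blast
qed

section \<open>Elementary abelian subgroups and maximal rank\<close>

text \<open>Passing to centralizers twice shows that commuting generators generate an abelian group,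
  in which the elements with trivial \<open>p\<close>-th power form a subgroup. The condition
  \<open>b [^] p = \<one>\<close>, unlike \<open>ord b = p\<close>, admits the identity as a
  generator.\<close>

lemma elem_abelian_generate:
  assumes p: "Factorial_Ring.prime p" and fin: "finite (carrier G)" and B: "B \<subseteq> carrier G"
    and comm: "\<And>a b. a \<in> B \<Longrightarrow> b \<in> B \<Longrightarrow> a \<otimes> b = b \<otimes> a"
    and pow: "\<And>b. b \<in> B \<Longrightarrow> b [^] p = \<one>"
  shows "elem_abelian G p (generate G B)"
proof -
  let ?H = "generate G B"
  have H: "subgroup ?H G" using B by (rule generate_is_subgroup)
  have Hc: "?H \<subseteq> carrier G" using H by (rule subgroup.subset)
  have "B \<subseteq> centralizer G B" using comm B by (auto simp: centralizer_def)
  then have "?H \<subseteq> centralizer G B" using subgroup_centralizer[OF B] by (rule generate_subgroup_incl)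
  then have "B \<subseteq> centralizer G ?H" using B by (auto simp: centralizer_def)
  then have "?H \<subseteq> centralizer G ?H" using subgroup_centralizer[OF Hc] by (rule generate_subgroup_incl)
  then have Hcomm: "x \<otimes> y = y \<otimes> x" if "x \<in> ?H" "y \<in> ?H" for x y
    using that by (auto simp: centralizer_def)
  let ?P = "{x \<in> ?H. x [^] p = \<one>}"
  have "subgroup ?P G"
  proof (rule subgroupI)
    show "?P \<subseteq> carrier G" using Hc by blast
    show "?P \<noteq> {}" using subgroup.one_closed[OF H] by (auto intro!: exI[of _ \<one>])
    show "inv a \<in> ?P" if "a \<in> ?P" for a
      using that Hc subgroup.m_inv_closed[OF H] by (auto simp: nat_pow_inv)
    show "a \<otimes> b \<in> ?P" if "a \<in> ?P" "b \<in> ?P" for a b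
      using that Hc subgroup.m_closed[OF H] Hcomm pow_mult_distrib[of a b p] by auto
  qed
  moreover have "B \<subseteq> ?P" using pow generate.incl[of _ B G] by auto
  ultimately have "?H \<subseteq> ?P" by (intro generate_subgroup_incl)
  then have "ord x = p" if "x \<in> ?H" "x \<noteq> \<one>" for x
  proof -
    have x: "x \<in> carrier G" "x [^] p = \<one>" using that \<open>?H \<subseteq> ?P\<close> Hc by auto
    then have "ord x dvd p" by (simp add: pow_eq_id)
    moreover have "ord x \<noteq> 1" using ord_eq_1[OF x(1)] that by simp
    ultimately show ?thesis using p by (auto simp: prime_nat_iff)
  qed
  then show ?thesis
    using H Hcomm finite_subset[OF Hc fin] by (auto simp: elem_abelian_def)
qed

lemma elem_abelian_pow:
  assumes "elem_abelian G p E" "x \<in> E"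
  shows "x [^] p = \<one>"
proof (cases "x = \<one>")
  case False
  then have "ord x = p" "x \<in> carrier G"
    using assms subgroup.mem_carrier by (auto simp: elem_abelian_def)
  then show ?thesis using pow_ord_eq_1 by blast
qed simp

text \<open>Trades ranks for orders, which are what the replacement argument compares: the order of
  each elementary abelian subgroup is \<open>p\<close> to its rank.\<close>

lemma max_rank_iff:
  assumes p: "Factorial_Ring.prime p" and G: "p_group G p" and E: "elem_abelian G p E"
  shows "elem_ab_rank p E = p_rank G p \<longleftrightarrow> (\<forall>F. elem_abelian G p F \<longrightarrow> card F \<le> card E)"
proof -
  have p1: "p > 1" using p by (rule prime_gt_1_nat)
  have rank: "card F = p ^ elem_ab_rank p F" if F: "elem_abelian G p F" for F
  proof -
    obtain k where k: "card F = p ^ k"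
      using subgroup_card_prime_power[OF p G] F by (auto simp: elem_abelian_def)
    then have "elem_ab_rank p F = k"
      unfolding elem_ab_rank_def using p1 by (intro the_equality) (simp_all add: power_inject_exp)
    then show ?thesis using k by simp
  qed
  let ?R = "{elem_ab_rank p F |F. elem_abelian G p F}"
  have "?R \<subseteq> elem_ab_rank p ` Pow (carrier G)"
    by (auto simp: elem_abelian_def dest: subgroup.subset)
  moreover have "finite (carrier G)" using G by (simp add: p_group_def)
  ultimately have fin: "finite ?R" by (meson finite_Pow_iff finite_imageI finite_subset)
  have "elem_ab_rank p E = p_rank G p \<longleftrightarrow> (\<forall>r\<in>?R. r \<le> elem_ab_rank p E)"
  proof
    assume "elem_ab_rank p E = p_rank G p"
    then show "\<forall>r\<in>?R. r \<le> elem_ab_rank p E" using Max_ge[OF fin] by (simp add: p_rank_def)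
  next
    assume "\<forall>r\<in>?R. r \<le> elem_ab_rank p E"
    then have "Max ?R = elem_ab_rank p E" using E by (intro Max_eqI[OF fin]) auto
    then show "elem_ab_rank p E = p_rank G p" by (simp add: p_rank_def)
  qed
  also have "\<dots> \<longleftrightarrow> (\<forall>F. elem_abelian G p F \<longrightarrow> elem_ab_rank p F \<le> elem_ab_rank p E)" by auto
  also have "\<dots> \<longleftrightarrow> (\<forall>F. elem_abelian G p F \<longrightarrow> card F \<le> card E)"
    using rank E p1 by (metis power_increasing_iff)
  finally show ?thesis .
qed


section \<open>Thompson's replacement argument\<close>

lemma normal_Omega1:
  assumes C: "C \<lhd> G"
  shows "Omega1 G p C \<lhd> G"
  unfolding Omega1_def
proof (rule normal_generateI)
  show "{x \<in> C. ord x = p} \<subseteq> carrier G"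
    using C by (auto dest!: normal_imp_subgroup simp: subgroup.mem_carrier)
  fix h g assume h: "h \<in> {x \<in> C. ord x = p}" and g: "g \<in> carrier G"
  have hc: "h \<in> carrier G" using h C by (auto dest!: normal_imp_subgroup simp: subgroup.mem_carrier)
  have pow: "(g \<otimes> h \<otimes> inv g) [^] n = g \<otimes> h [^] n \<otimes> inv g" for n :: nat
    using g hc by (induction n) (simp_all add: m_assoc)
  have "(g \<otimes> h \<otimes> inv g) [^] n = \<one> \<longleftrightarrow> h [^] n = \<one>" for n :: nat
  proof
    assume "(g \<otimes> h \<otimes> inv g) [^] n = \<one>"
    then have "inv g \<otimes> (g \<otimes> h [^] n \<otimes> inv g) \<otimes> g = inv g \<otimes> \<one> \<otimes> g" unfolding pow by simp
    then show "h [^] n = \<one>" using g hc by (simp add: m_assoc)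
  next
    assume "h [^] n = \<one>"
    then show "(g \<otimes> h \<otimes> inv g) [^] n = \<one>" unfolding pow using g by simp
  qed
  then have "ord (g \<otimes> h \<otimes> inv g) = ord h" unfolding ord_def by simp
  then show "g \<otimes> h \<otimes> inv g \<in> {x \<in> C. ord x = p}"
    using h normal.inv_op_closed2[OF C g] by simp
qed

text \<open>Some \<open>x\<close> in \<open>V\<close> does not normalize \<open>E\<close>, although
  all \<open>[x, a]\<close> with \<open>a\<close> in \<open>E\<close> do. The new group is generated
  by these commutators and by the part \<open>C\<close> of \<open>E\<close> whose commutators with
  \<open>x\<close> stay in \<open>E\<close>. It gains elements of \<open>V\<close> outside
  \<open>E\<close>, loses no order, and misses \<open>x\<close> because it normalizes
  \<open>E\<close>.\<close>

lemma thompson_replacement: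
  assumes p: "Factorial_Ring.prime p" and G: "p_group G p"
    and E: "elem_abelian G p E" and V: "elem_abelian G p V" "V \<lhd> G"
    and notnorm: "\<not> (\<forall>v\<in>V. \<forall>a\<in>E. commutator v a \<in> E)"
  obtains A where "elem_abelian G p A" "card E \<le> card A" "E \<inter> V \<subset> A \<inter> V" "\<not> V \<subseteq> A"
proof -
  have fin: "finite (carrier G)" using G by (simp add: p_group_def)
  have Es: "subgroup E G" and Ecomm: "\<And>a b. a \<in> E \<Longrightarrow> b \<in> E \<Longrightarrow> a \<otimes> b = b \<otimes> a"
    using E by (auto simp: elem_abelian_def)
  have Vs: "subgroup V G" and Vcomm: "\<And>a b. a \<in> V \<Longrightarrow> b \<in> V \<Longrightarrow> a \<otimes> b = b \<otimes> a"
    using V by (auto simp: elem_abelian_def)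
  have Ec [simp]: "a \<in> E \<Longrightarrow> a \<in> carrier G" for a using subgroup.mem_carrier[OF Es] .
  have Vc [simp]: "a \<in> V \<Longrightarrow> a \<in> carrier G" for a using subgroup.mem_carrier[OF Vs] .
  have Vcommutator: "commutator v a \<in> V" if "v \<in> V" "a \<in> E" for v a
    using commutator_mem_normal[OF V(2)] that by simp
  note Eclosed = subgroup.m_closed[OF Es] subgroup.m_inv_closed[OF Es] subgroup.one_closed[OF Es]
  note Vclosed = subgroup.m_closed[OF Vs] subgroup.m_inv_closed[OF Vs] subgroup.one_closed[OF Vs]
  \<comment> \<open>This is the normalizer of \<open>E\<close> in \<open>V\<close>, in commutator
    form.\<close>
  define N where "N = {v \<in> V. \<forall>a\<in>E. commutator v a \<in> E}"
  have Ns: "subgroup N G"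
  proof (rule subgroupI)
    show "N \<subseteq> carrier G" by (auto simp: N_def)
    show "N \<noteq> {}" using Vclosed Eclosed by (auto simp: N_def intro!: exI[of _ \<one>])
  next
    fix v assume v: "v \<in> N"
    have "commutator (inv v) a \<in> E" if a: "a \<in> E" for a
    proof -
      have [simp]: "v \<in> V" "v \<in> carrier G" "a \<in> carrier G" using v a by (auto simp: N_def)
      have "commutator (inv v) a = v \<otimes> inv (commutator v a) \<otimes> inv v"
        by (simp add: m_assoc inv_mult_group)
      also have "\<dots> = inv (commutator v a) \<otimes> v \<otimes> inv v"
        using Vcomm[of v "inv (commutator v a)"] Vcommutator[of v a] a Vclosed by simp
      also have "\<dots> = inv (commutator v a)" by (simp add: m_assoc)
      finally show ?thesis using v a Eclosed by (simp add: N_def)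
    qed
    then show "inv v \<in> N" using v Vclosed by (simp add: N_def)
  next
    fix v w assume v: "v \<in> N" and w: "w \<in> N"
    have "commutator (v \<otimes> w) a \<in> E" if a: "a \<in> E" for a
    proof -
      have [simp]: "v \<in> V" "v \<in> carrier G" "w \<in> V" "w \<in> carrier G" "a \<in> carrier G"
        using v w a by (auto simp: N_def)
      have "commutator (v \<otimes> w) a = inv w \<otimes> (commutator v a \<otimes> w) \<otimes> commutator w a"
        by (simp add: m_assoc inv_mult_group)
      also have "\<dots> = inv w \<otimes> (w \<otimes> commutator v a) \<otimes> commutator w a"
        using Vcomm[of w "commutator v a"] Vcommutator[of v a] a by simp
      also have "\<dots> = commutator v a \<otimes> commutator w a" by (simp add: m_assoc)
      finally show ?thesis using v w a Eclosed by (simp add: N_def)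
    qed
    then show "v \<otimes> w \<in> N" using v w Vclosed by (simp add: N_def)
  qed
  have NV: "N \<subset> V" using notnorm by (auto simp: N_def)
  \<comment> \<open>\<open>x\<close> represents a coset of \<open>N\<close> in \<open>V\<close>,
    other than \<open>N\<close>, that is fixed by \<open>E\<close>.\<close>
  obtain x where x: "x \<in> V" "x \<notin> N" "\<And>a. a \<in> E \<Longrightarrow> commutator x a \<in> N"
  proof (rule ex_fixed_mod_subgroup[OF p G Es Vs Ns NV])
    show "s \<otimes> k \<otimes> inv s \<in> V" if "s \<in> E" "k \<in> V" for s k
      using normal.inv_op_closed2[OF V(2)] that by simp
    show "s \<otimes> k \<otimes> inv s \<in> N" if s: "s \<in> E" and k: "k \<in> N" for s k
    proof -
      have [simp]: "s \<in> carrier G" "k \<in> V" using s k by (auto simp: N_def)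
      have "commutator (s \<otimes> k \<otimes> inv s) a \<in> E" if a: "a \<in> E" for a
      proof -
        let ?a = "inv s \<otimes> a \<otimes> s"
        have "s \<otimes> commutator k ?a \<otimes> inv s \<in> E"
          using s k a Eclosed by (simp add: N_def)
        moreover have "s \<otimes> commutator k ?a \<otimes> inv s = commutator (s \<otimes> k \<otimes> inv s) a"
          using a by (simp add: m_assoc inv_mult_group)
        ultimately show ?thesis by simp
      qed
      then show ?thesis using normal.inv_op_closed2[OF V(2)] by (simp add: N_def)
    qed
  qed blast
  have xc [simp]: "x \<in> carrier G" using x by simp
  \<comment> \<open>Equivalently, \<open>C\<close> is the intersection of \<open>E\<close> with its
    conjugate \<open>x E inv x\<close>.\<close>
  define C where "C = {a \<in> E. commutator x a \<in> E}"
  \<comment> \<open>Elements of \<open>E\<close> whose commutators with \<open>x\<close> agree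
    modulo \<open>E\<close> lie in the same coset of \<open>C\<close>. This makes \<open>C\<close> a
    subgroup and later gives the injectivity of \<open>f\<close>.\<close>
  have quot: "commutator x (a \<otimes> inv b) \<in> E"
    if a: "a \<in> E" and b: "b \<in> E" and ab: "inv (commutator x b) \<otimes> commutator x a \<in> E" for a b
  proof -
    have "commutator x (a \<otimes> inv b) = b \<otimes> (inv (commutator x b) \<otimes> commutator x a) \<otimes> inv b"
      using a b by (simp add: m_assoc inv_mult_group)
    then show ?thesis using Eclosed ab b by simp
  qed
  have Cdiv: "a \<otimes> inv b \<in> C" if "a \<in> C" "b \<in> C" for a b
    using that quot Eclosed by (simp add: C_def)
  have oneC: "\<one> \<in> C" using Eclosed by (simp add: C_def)
  have Cs: "subgroup C G"
  proof (rule subgroupI)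
    show "C \<subseteq> carrier G" by (auto simp: C_def)
    show "C \<noteq> {}" using oneC by blast
    show inv: "inv a \<in> C" if "a \<in> C" for a
      using Cdiv[OF oneC that] that by (simp add: C_def)
    show "a \<otimes> b \<in> C" if "a \<in> C" "b \<in> C" for a b
      using Cdiv[OF that(1) inv[OF that(2)]] that by (simp add: C_def)
  qed
  have EVC: "E \<inter> V \<subseteq> C"
  proof
    fix d assume d: "d \<in> E \<inter> V"
    have "commutator x d = inv x \<otimes> inv d \<otimes> (x \<otimes> d)" using d by (simp add: m_assoc)
    also have "\<dots> = \<one>" unfolding Vcomm[OF x(1), of d, OF IntD2[OF d]] using d by (simp add: m_assoc)
    finally show "d \<in> C" using d Eclosed by (simp add: C_def)
  qed
  define M where "M = commutator x ` E"
  have MV: "M \<subseteq> V" using Vcommutator x(1) by (auto simp: M_def)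
  define A where "A = generate G (M \<union> C)"
  have MCc: "M \<union> C \<subseteq> carrier G" using MV by (auto simp: C_def)
  have CM: "c \<otimes> m = m \<otimes> c" if c: "c \<in> C" and m: "m \<in> M" for c m
  proof -
    obtain b where b: "b \<in> E" "m = commutator x b" using m by (auto simp: M_def)
    have cE: "c \<in> E" using c by (simp add: C_def)
    have [simp]: "b \<in> carrier G" "c \<in> carrier G" using b cE by auto
    \<comment> \<open>With \<open>x\<^sup>y = y\<^sup>-\<^sup>1xy\<close>, commutation of \<open>[x,c]\<close> with \<open>b\<close> and commutation of \<open>[x,b]\<close> with \<open>c\<close>
      both say \<open>x x\<^bsup>bc\<^esup> = x\<^sup>b x\<^sup>c\<close>.\<close>
    let ?xb = "inv b \<otimes> x \<otimes> b" and ?xc = "inv c \<otimes> x \<otimes> c" and ?y = "inv (b \<otimes> c) \<otimes> x \<otimes> (b \<otimes> c)"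
    have inV: "?xb \<in> V" "?xc \<in> V" "?y \<in> V"
      using normal.inv_op_closed1[OF V(2) _ x(1)] by simp_all
    have "commutator x c \<otimes> b = b \<otimes> commutator x c"
      using Ecomm c b(1) by (simp add: C_def)
    then have "inv b \<otimes> (commutator x c \<otimes> b) = commutator x c" using b cE by simp
    moreover have "inv b \<otimes> (commutator x c \<otimes> b) = inv ?xb \<otimes> (inv (c \<otimes> b) \<otimes> x \<otimes> (c \<otimes> b))"
      by (simp add: m_assoc inv_mult_group)
    ultimately have 1: "inv ?xb \<otimes> ?y = inv x \<otimes> ?xc"
      unfolding Ecomm[OF cE b(1)] by (simp add: m_assoc)
    have "?y = ?xb \<otimes> (inv ?xb \<otimes> ?y)" by simp
    also have "\<dots> = ?xb \<otimes> inv x \<otimes> ?xc" unfolding 1 by (simp add: m_assoc)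
    also have "\<dots> = ?xc \<otimes> (inv x \<otimes> ?xb)"
      using Vcomm[of "?xb \<otimes> inv x" ?xc] Vcomm[of ?xb "inv x"] inV x(1) Vclosed by simp
    finally have "inv ?xc \<otimes> ?y = inv x \<otimes> ?xb" by (simp add: m_assoc inv_mult_group)
    moreover have "inv ?xc \<otimes> ?y = inv c \<otimes> m \<otimes> c"
      unfolding b(2) by (simp add: m_assoc inv_mult_group)
    moreover have "inv x \<otimes> ?xb = m" unfolding b(2) by (simp add: m_assoc)
    ultimately have "inv c \<otimes> m \<otimes> c = m" by simp
    then have "c \<otimes> (inv c \<otimes> m \<otimes> c) = c \<otimes> m" by simp
    then show ?thesis using b by (simp add: m_assoc)
  qed
  have A: "elem_abelian G p A"
    unfolding A_def
  proof (rule elem_abelian_generate[OF p fin MCc])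
    show "b [^] p = \<one>" if "b \<in> M \<union> C" for b
      using that MV elem_abelian_pow[OF V(1)] elem_abelian_pow[OF E] by (auto simp: C_def)
    show "a \<otimes> b = b \<otimes> a" if ab: "a \<in> M \<union> C" "b \<in> M \<union> C" for a b
    proof -
      have "a \<in> C \<Longrightarrow> b \<in> C \<Longrightarrow> ?thesis" using Ecomm by (simp add: C_def)
      moreover have "a \<in> M \<Longrightarrow> b \<in> M \<Longrightarrow> ?thesis" using Vcomm MV by blast
      moreover have "a \<in> C \<Longrightarrow> b \<in> M \<Longrightarrow> ?thesis" by (rule CM)
      moreover have "a \<in> M \<Longrightarrow> b \<in> C \<Longrightarrow> ?thesis" using CM by metis
      ultimately show ?thesis using ab by blast
    qed
  qed
  have As: "subgroup A G" using A by (simp add: elem_abelian_def)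
  have MCA: "M \<subseteq> A" "C \<subseteq> A" by (auto simp: A_def intro: generate.incl)
  \<comment> \<open>The choice depends on the coset \<open>C #> a\<close> only, so \<open>t\<close>
    is a transversal of \<open>C\<close> in \<open>E\<close>.\<close>
  define t where "t a = (SOME b. b \<in> C #> a)" for a
  have t: "t a \<in> C #> a" if "a \<in> E" for a
    unfolding t_def using rcos_self[OF Ec[OF that] Cs] by (rule someI)
  have tE: "t a \<in> E" "t a \<otimes> inv a \<in> C" if a: "a \<in> E" for a
  proof -
    obtain c where c: "c \<in> C" "t a = c \<otimes> a" using t[OF a] by (auto simp: r_coset_def)
    then have "c \<in> E" by (simp add: C_def)
    then show "t a \<in> E" "t a \<otimes> inv a \<in> C" using c a Eclosed by (simp_all add: m_assoc)
  qed
  \<comment> \<open>The first factor, in \<open>M\<close>, records the coset of \<open>a\<close>;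
    the second, in \<open>C\<close>, records the place of \<open>a\<close> within it. The injection
    bounds \<open>card E\<close> by \<open>card A\<close> without computing indices.\<close>
  define f where "f a = commutator x (t a) \<otimes> (t a \<otimes> inv a)" for a
  have "inj_on f E"
  proof (rule inj_onI)
    fix a b assume a: "a \<in> E" and b: "b \<in> E" and eq: "f a = f b"
    let ?c = "t a \<otimes> inv a" and ?d = "t b \<otimes> inv b"
    have [simp]: "a \<in> carrier G" "b \<in> carrier G" "t a \<in> carrier G" "t b \<in> carrier G"
      using a b tE(1)[OF a] tE(1)[OF b] by auto
    have cd: "?c \<in> C" "?d \<in> C" using tE a b by auto
    have "inv (commutator x (t b)) \<otimes> commutator x (t a) = inv (commutator x (t b)) \<otimes> (f a \<otimes> inv ?c)"
      by (simp add: f_def m_assoc inv_mult_group)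
    also have "\<dots> = ?d \<otimes> inv ?c" unfolding eq by (simp add: f_def m_assoc inv_mult_group)
    also have "\<dots> \<in> E" using Cdiv[OF cd(2,1)] by (simp add: C_def)
    finally have "t a \<otimes> inv (t b) \<in> C"
      using quot[OF tE(1)[OF a] tE(1)[OF b]] tE(1)[OF a] tE(1)[OF b] Eclosed by (simp add: C_def)
    then have "C #> t a = C #> t b"
      using coset_join2[OF _ Cs] coset_mult_inv1[of C "t a" "t b"] subgroup.subset[OF Cs] by auto
    moreover have "C #> t a = C #> a" "C #> t b = C #> b"
      using repr_independence[OF t[OF a] _ Cs] repr_independence[OF t[OF b] _ Cs] by simp_all
    ultimately have tt: "t a = t b" unfolding t_def by simp
    then have "t a \<otimes> inv a = t a \<otimes> inv b" using eq unfolding f_def tt by simp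
    then have "inv a = inv b" by simp
    then show "a = b" by (metis inv_inv \<open>a \<in> carrier G\<close> \<open>b \<in> carrier G\<close>)
  qed
  moreover have "f ` E \<subseteq> A"
  proof (rule image_subsetI)
    fix a assume a: "a \<in> E"
    have "commutator x (t a) \<in> A" using MCA(1) tE(1)[OF a] by (auto simp: M_def)
    moreover have "t a \<otimes> inv a \<in> A" using MCA(2) tE(2)[OF a] by blast
    ultimately show "f a \<in> A" unfolding f_def by (rule subgroup.m_closed[OF As])
  qed
  moreover have "finite A" using A by (simp add: elem_abelian_def)
  ultimately have card: "card E \<le> card A" by (rule card_inj_on_le)
  \<comment> \<open>This commutator makes the inclusion of intersections with \<open>V\<close>
    strict, and also shows that \<open>x\<close> does not normalize \<open>E\<close>.\<close>
  obtain a where a: "a \<in> E" "commutator x a \<notin> E" using x(1,2) by (auto simp: N_def)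
  have "commutator x a \<in> A \<inter> V" using a MV MCA by (auto simp: M_def)
  then have psub: "E \<inter> V \<subset> A \<inter> V" using EVC MCA a by blast
  \<comment> \<open>The normalizer of \<open>E\<close>, with both directions of conjugation so that
    closure under inverses is immediate. It contains the generators of \<open>A\<close>, as
    \<open>M \<subseteq> N\<close> and \<open>C \<subseteq> E\<close>, but not
    \<open>x\<close>.\<close>
  define R where "R = {g \<in> carrier G. \<forall>e\<in>E. g \<otimes> e \<otimes> inv g \<in> E \<and> inv g \<otimes> e \<otimes> g \<in> E}"
  have Rs: "subgroup R G"
  proof (rule subgroupI)
    show "R \<subseteq> carrier G" by (auto simp: R_def)
    show "R \<noteq> {}" by (auto simp: R_def intro!: exI[of _ \<one>])
    show "inv g \<in> R" if "g \<in> R" for g using that by (simp add: R_def)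
    fix g h assume g: "g \<in> R" and h: "h \<in> R"
    have "g \<otimes> h \<otimes> e \<otimes> inv (g \<otimes> h) = g \<otimes> (h \<otimes> e \<otimes> inv h) \<otimes> inv g"
      "inv (g \<otimes> h) \<otimes> e \<otimes> (g \<otimes> h) = inv h \<otimes> (inv g \<otimes> e \<otimes> g) \<otimes> h" if "e \<in> E" for e
      using g h that by (simp_all add: R_def m_assoc inv_mult_group)
    then show "g \<otimes> h \<in> R" using g h by (simp add: R_def)
  qed
  have conjN: "inv v \<otimes> e \<otimes> v \<in> E" if v: "v \<in> N" and e: "e \<in> E" for v e
  proof -
    have "commutator v (inv e) \<in> E" using v Eclosed(2)[OF e] unfolding N_def by blast
    then have "commutator v (inv e) \<otimes> e \<in> E" using e by (rule Eclosed(1))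
    moreover have "commutator v (inv e) \<otimes> e = inv v \<otimes> e \<otimes> v"
      using v e by (simp add: N_def m_assoc)
    ultimately show ?thesis by simp
  qed
  have "N \<subseteq> R"
  proof
    fix v assume v: "v \<in> N"
    have vc: "v \<in> carrier G" using v by (simp add: N_def)
    have "inv v \<in> N" using v Ns by (simp add: subgroup.m_inv_closed)
    then have "v \<otimes> e \<otimes> inv v \<in> E" if "e \<in> E" for e using conjN[of "inv v" e] that vc by simp
    then show "v \<in> R" using conjN v vc by (simp add: R_def)
  qed
  moreover have "M \<subseteq> N" using x(3) by (auto simp: M_def)
  moreover have "C \<subseteq> R" using Eclosed by (auto simp: C_def R_def)
  ultimately have AR: "A \<subseteq> R"
    unfolding A_def using Rs by (intro generate_subgroup_incl) auto
  have "x \<notin> A"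
  proof
    assume "x \<in> A"
    then have "x \<in> R" using AR by blast
    then have "commutator x a \<in> E" using a Eclosed by (simp add: R_def)
    then show False using a by blast
  qed
  then have "\<not> V \<subseteq> A" using x(1) by blast
  then show ?thesis using that A card psub by blast
qed

end

section \<open>The Thompson subgroup lies in the Oliver subgroup\<close>

theorem theorem1p5:
  fixes S :: "('a, 'b) monoid_scheme" and p :: nat
  assumes "Factorial_Ring.prime p" and "odd p"
    and "p_group S p"
    and "\<And>L. subgroup L S \<Longrightarrow> oliver_subgroup S p \<subseteq> L \<Longrightarrow>
           L \<subseteq> thompson_subgroup S p <#>\<^bsub>S\<^esub> oliver_subgroup S p \<Longrightarrow> L \<lhd> S"
  shows "thompson_subgroup S p \<subseteq> oliver_subgroup S p"
proof -
  interpret group S using assms(3) by (simp add: p_group_def)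
  define U where "U = oliver_subgroup S p"
  define \<A> where "\<A> = {E. elem_abelian S p E \<and> elem_ab_rank p E = p_rank S p}"
  define V where "V = Omega1 S p (centralizer S U)"
  note p = assms(1) and G = assms(3)
  have fin: "finite (carrier S)" using G by (simp add: p_group_def)
  have p1: "p > 1" using p by (rule prime_gt_1_nat)
  have p3: "p - 1 = Suc (Suc (p - 3))" using p1 assms(2) by (cases "p = 2") auto
  have U: "U \<lhd> S"
    using oliver_subgroup_greatest(1)[OF p1 fin] by (simp add: U_def oliver_admissible_def)
  have Us: "subgroup U S" using U by (rule normal_imp_subgroup)
  have Uc: "U \<subseteq> carrier S" using Us by (rule subgroup.subset)
  have CU: "centralizer S U \<subseteq> U"
    using centralizer_oliver_subset[OF p assms(2) G] by (simp add: U_def)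
  have VC: "V \<subseteq> centralizer S U"
    unfolding V_def by (rule Omega1_subset[OF subgroup_centralizer[OF Uc]]) blast
  have Vn: "V \<lhd> S" unfolding V_def by (intro normal_Omega1 normal_centralizer U)
  \<comment> \<open>The centralizer of \<open>U\<close> is abelian because it lies in
    \<open>U\<close>, which it centralizes; so the generators of \<open>V\<close> commute.\<close>
  have V: "elem_abelian S p V"
    unfolding V_def Omega1_def
  proof (rule elem_abelian_generate[OF p fin])
    show "{x \<in> centralizer S U. ord x = p} \<subseteq> carrier S" by (auto simp: centralizer_def)
    show "a \<otimes>\<^bsub>S\<^esub> b = b \<otimes>\<^bsub>S\<^esub> a" if "a \<in> {x \<in> centralizer S U. ord x = p}" "b \<in> {x \<in> centralizer S U. ord x = p}" for a b
      using that CU by (auto simp: centralizer_def)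
    show "b [^]\<^bsub>S\<^esub> p = \<one>\<^bsub>S\<^esub>" if "b \<in> {x \<in> centralizer S U. ord x = p}" for b
      using that pow_ord_eq_1[of b] by (auto simp: centralizer_def)
  qed
  have VUcomm: "v \<otimes>\<^bsub>S\<^esub> u = u \<otimes>\<^bsub>S\<^esub> v" if "v \<in> V" "u \<in> U" for u v
    using that VC by (auto simp: centralizer_def)
  have max: "card F \<le> card E" if "E \<in> \<A>" "elem_abelian S p F" for E F
    using that max_rank_iff[OF p G] by (auto simp: \<A>_def)
  have "E \<subseteq> U" if "E \<in> \<A>" for E
  proof (rule ccontr)
    assume "\<not> E \<subseteq> U"
    define \<B> where "\<B> = {E \<in> \<A>. \<not> E \<subseteq> U}"
    have "\<B> \<subseteq> Pow (carrier S)"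
      by (auto simp: \<B>_def \<A>_def elem_abelian_def dest: subgroup.mem_carrier)
    then have "finite \<B>" using fin by (meson finite_Pow_iff finite_subset)
    moreover have "\<B> \<noteq> {}" using that \<open>\<not> E \<subseteq> U\<close> by (auto simp: \<B>_def)
    \<comment> \<open>\<open>D\<close> is the bad subgroup whose intersection with \<open>V\<close>
      is largest.\<close>
    ultimately obtain D where D: "D \<in> \<B>" "\<And>F. F \<in> \<B> \<Longrightarrow> card (F \<inter> V) \<le> card (D \<inter> V)"
      using Max_in[of "(\<lambda>F. card (F \<inter> V)) ` \<B>"] Max_ge[of "(\<lambda>F. card (F \<inter> V)) ` \<B>"] by fastforce
    have DA: "D \<in> \<A>" and DU: "\<not> D \<subseteq> U" and De: "elem_abelian S p D"
      using D(1) by (auto simp: \<B>_def \<A>_def)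
    have Ds: "subgroup D S" using De by (simp add: elem_abelian_def)
    have Dc: "D \<subseteq> carrier S" using Ds by (rule subgroup.subset)
    show False
    proof (cases "\<forall>v\<in>V. \<forall>a\<in>D. commutator v a \<in> D")
      case True
      \<comment> \<open>The hypothesis on normality has \<open>U\<close> as right factor, while
        \<open>iter_comm_set_mult\<close> needs it as left factor.\<close>
      have eq: "D <#>\<^bsub>S\<^esub> U = U <#>\<^bsub>S\<^esub> D" using commut_normal[OF Ds U] .
      have "D \<subseteq> thompson_subgroup S p"
        unfolding thompson_subgroup_def using DA by (auto simp: \<A>_def intro: generate.incl)
      then have "U <#>\<^bsub>S\<^esub> D \<subseteq> thompson_subgroup S p <#>\<^bsub>S\<^esub> U"
        unfolding eq[symmetric] by (auto simp: set_mult_def)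
      moreover have UL: "U \<subseteq> U <#>\<^bsub>S\<^esub> D"
        using Uc subgroup.one_closed[OF Ds] by (force simp: set_mult_def)
      ultimately have L: "U <#>\<^bsub>S\<^esub> D \<lhd> S"
        using assms(4) mult_norm_subgroup[OF U Ds] by (simp add: U_def)
      have DVs: "subgroup (D \<inter> V) S"
        using Ds Vn by (simp add: normal_imp_subgroup subgroups_Inter_pair)
      \<comment> \<open>\<open>V\<close> normalizes \<open>D\<close> and is normal, so
        \<open>[V, D]\<close> lies in \<open>D \<inter> V\<close>, which the abelian group
        \<open>D\<close> centralizes.\<close>
      have "iter_comm S V D (Suc (Suc (p - 3))) = {\<one>\<^bsub>S\<^esub>}"
      proof (rule iter_comm_eq_one_Suc_Suc[OF _ Dc DVs])
        show "V \<subseteq> carrier S" using Vn by (simp add: normal_imp_subgroup subgroup.subset)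
        then show "commutator a b \<in> D \<inter> V" if "a \<in> V" "b \<in> D" for a b
          using that True commutator_mem_normal[OF Vn, of a b] Dc by blast
        show "h \<otimes>\<^bsub>S\<^esub> b = b \<otimes>\<^bsub>S\<^esub> h" if "h \<in> D \<inter> V" "b \<in> D" for h b
          using that De by (simp add: elem_abelian_def)
      qed
      then have "iter_comm S V (U <#>\<^bsub>S\<^esub> D) (p - 1) \<subseteq> {\<one>\<^bsub>S\<^esub>}"
        using iter_comm_set_mult[OF U VC Dc, of "p - 1"] p3 by simp
      then have "iter_comm S V (U <#>\<^bsub>S\<^esub> D) (p - 1) = {\<one>\<^bsub>S\<^esub>}"
        using one_mem_iter_comm[of "p - 1"] p3 by fastforce
      then have "U <#>\<^bsub>S\<^esub> D \<subseteq> U"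
        using subset_oliver_subgroup[OF p1 fin L] UL by (simp add: U_def V_def)
      moreover have "D \<subseteq> U <#>\<^bsub>S\<^esub> D"
        using Dc subgroup.one_closed[OF Us] by (force simp: set_mult_def)
      ultimately show False using DU by blast
    next
      case False
      obtain A where A: "elem_abelian S p A" "card D \<le> card A" "D \<inter> V \<subset> A \<inter> V" "\<not> V \<subseteq> A"
        using thompson_replacement[OF p G De V Vn False] .
      have maxA: "card F \<le> card A" if "elem_abelian S p F" for F
        using max[OF DA that] A(2) by simp
      then have AA: "A \<in> \<A>" using max_rank_iff[OF p G A(1)] A(1) by (simp add: \<A>_def)
      have finA: "finite A" using A(1) by (simp add: elem_abelian_def)
      have "card (D \<inter> V) < card (A \<inter> V)" using A(3) finA by (intro psubset_card_mono) auto
      \<comment> \<open>\<open>A\<close> also has maximal rank but meets \<open>V\<close> in more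
        elements than \<open>D\<close> does, so the choice of \<open>D\<close> forces
        \<open>A\<close> into \<open>U\<close>.\<close>
      then have "A \<notin> \<B>" using D(2) by fastforce
      then have AU: "A \<subseteq> U" using AA by (simp add: \<B>_def)
      have VAc: "V \<union> A \<subseteq> carrier S" using AU CU VC Uc by blast
      \<comment> \<open>\<open>V\<close> centralizes \<open>U\<close>, hence \<open>A\<close>. As
        \<open>A\<close> has maximal order, the group generated by both is \<open>A\<close> itself,
        against \<open>\<not> V \<subseteq> A\<close>.\<close>
      have F: "elem_abelian S p (generate S (V \<union> A))"
      proof (rule elem_abelian_generate[OF p fin VAc])
        show "b [^]\<^bsub>S\<^esub> p = \<one>\<^bsub>S\<^esub>" if "b \<in> V \<union> A" for b
          using that elem_abelian_pow[OF V] elem_abelian_pow[OF A(1)] by blast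
        show "a \<otimes>\<^bsub>S\<^esub> b = b \<otimes>\<^bsub>S\<^esub> a" if "a \<in> V \<union> A" "b \<in> V \<union> A" for a b
        proof (cases "a \<in> V \<or> b \<in> V")
          case True
          have "a \<in> U" "b \<in> U" using that AU VC CU by auto
          then show ?thesis using True VUcomm[of a b] VUcomm[of b a] by auto
        next
          case False
          then show ?thesis using that A(1) by (simp add: elem_abelian_def)
        qed
      qed
      have "A \<subseteq> generate S (V \<union> A)" "V \<subseteq> generate S (V \<union> A)" by (auto intro: generate.incl)
      moreover have "finite (generate S (V \<union> A))" using F by (simp add: elem_abelian_def)
      ultimately have "V \<subseteq> A" using maxA[OF F] card_seteq by blast
      then show False using A(4) by blast
    qed
  qed
  then have "\<Union>\<A> \<subseteq> U" by blast
  then show ?thesis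
    unfolding thompson_subgroup_def \<A>_def[symmetric] U_def[symmetric]
    by (rule generate_subgroup_incl[OF _ Us])
qed

end
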